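(* Let $\mathbb{F}$ be a finite field. Then its multiplicative group $\mathbb{F}^{*}=\mathbb{F}\setminus\{0\}$ is cyclic. *)

theory Defs
  imports "HOL-Algebra.Multiplicative_Group" "HOL-Algebra.Elementary_Groups"
begin

end

theory Submission
  imports Defs
begin

text \<open>For each d dividing the group order n, x^d - 1 has at most d roots in a field, so at
  most phi(d) elements have order d; since phi(d) sums to n over d | n, some element has order n.
  \<open>finite_field_mult_group_has_gen\<close> supplies this generator; what remains is to pass
  from natural to integer powers.\<close>

theorem theorem1p6:
  fixes F :: "('a, 'b) ring_scheme" (structure)
  assumes "field F"
    and "finite (carrier F)"
  shows "cyclic_group (mult_of F)"
proof -
  interpret field F by (rule assms(1))
  interpret G: group "mult_of F" by (rule field_mult_group)
  obtain a where a: "a \<in> carrier (mult_of F)"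
    and gen: "carrier (mult_of F) = {a [^] i | i::nat. i \<in> UNIV}"
    using finite_field_mult_group_has_gen[OF assms(2)] by blast
  \<comment> \<open>The criterion \<open>G.cyclic_group\<close> asks for integer powers taken in
    \<open>mult_of F\<close>, whereas \<open>gen\<close> has natural powers taken in
    \<open>F\<close>.\<close>
  have "carrier (mult_of F) = range (\<lambda>n::int. a [^]\<^bsub>mult_of F\<^esub> n)"
  proof
    show "carrier (mult_of F) \<subseteq> range (\<lambda>n::int. a [^]\<^bsub>mult_of F\<^esub> n)"
    proof
      fix x assume "x \<in> carrier (mult_of F)"
      then obtain i :: nat where "x = a [^] i"
        using gen by blast
      then have "x = a [^]\<^bsub>mult_of F\<^esub> int i"
        by (simp only: int_pow_int nat_pow_mult_of)
      then show "x \<in> range (\<lambda>n::int. a [^]\<^bsub>mult_of F\<^esub> n)"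
        by (rule range_eqI)
    qed
    show "range (\<lambda>n::int. a [^]\<^bsub>mult_of F\<^esub> n) \<subseteq> carrier (mult_of F)"
      using G.int_pow_closed[OF a] by blast
  qed
  with a show ?thesis
    using G.cyclic_group by blast
qed

end
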